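(* For every diagonal matrix $d\in D_n$, the set of idempotents $q\in M_n(\mathbb{C})$ such that $E(q)=d$ and $\{[q]\}'\cap D_n=\mathbb{C}\,\mathrm{id}$ is pathwise connected whenever it is not empty.
   Context: $D_n\subset M_n(\mathbb{C})$ is the algebra of diagonal matrices, and $E\colon M_n(\mathbb{C})\to D_n$ is the linear map that keeps the diagonal entries and replaces all off-diagonal entries by $0$. An idempotent is a matrix $q$ with $q^2=q$, and $[q]$ denotes its range projection, i.e. the orthogonal projection onto the range of $q$. For a matrix $x$, $\{x\}'$ denotes the set of matrices commuting with $x$. The set carries the topology inherited from $M_n(\mathbb{C})$. *)

theory Defs
  imports "HOL-Analysis.Analysis"
begin

definition diagonal_algebra :: "(complex^'n^'n) set" where
  "diagonal_algebra = {d. \<forall>i j. i \<noteq> j \<longrightarrow> d $ i $ j = 0}"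

definition diagonal_part :: "complex^'n^'n \<Rightarrow> complex^'n^'n" where
  "diagonal_part x = (\<chi> i j. if i = j then x $ i $ j else 0)"

definition idempotent_matrix :: "complex^'n^'n \<Rightarrow> bool" where
  "idempotent_matrix q \<longleftrightarrow> q ** q = q"

definition commutant :: "complex^'n^'n \<Rightarrow> (complex^'n^'n) set" where
  "commutant x = {y. x ** y = y ** x}"

definition conjugate_transpose :: "complex^'n^'n \<Rightarrow> complex^'n^'n" where
  "conjugate_transpose x = (\<chi> i j. cnj (x $ j $ i))"

definition orthogonal_projection :: "complex^'n^'n \<Rightarrow> bool" where
  "orthogonal_projection p \<longleftrightarrow> p ** p = p \<and> conjugate_transpose p = p"

definition range_projection :: "complex^'n^'n \<Rightarrow> complex^'n^'n" where
  "range_projection q =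
     (THE p. orthogonal_projection p \<and> range (\<lambda>v. p *v v) = range (\<lambda>v. q *v v))"

definition scalar_matrices :: "(complex^'n^'n) set" where
  "scalar_matrices = range mat"

lemma conjugate_transpose_mult:
  "conjugate_transpose (a ** b) = conjugate_transpose b ** conjugate_transpose a"
  by (simp add: conjugate_transpose_def matrix_matrix_mult_def vec_eq_iff mult.commute)

lemma projection_fixes_range:
  fixes p r :: "complex^'n^'n"
  assumes "p ** p = p" and "range (\<lambda>v. r *v v) \<subseteq> range (\<lambda>v. p *v v)"
  shows "p ** r = r"
proof -
  have "(p ** r) *v v = r *v v" for v
  proof -
    obtain w where w: "r *v v = p *v w" using assms(2) by blast
    show ?thesis using w assms(1)
      by (metis matrix_vector_mul_assoc)
  qed
  then show ?thesis by (simp add: matrix_eq)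
qed

lemma inner_complex_vec: "x \<bullet> y = Re (\<Sum>i\<in>UNIV. x $ i * cnj (y $ i))"
  for x y :: "complex^'n"
  by (simp add: inner_vec_def inner_complex_def)

lemma ex1_range_projection:
  fixes q :: "complex^'n^'n"
  shows "\<exists>!p. orthogonal_projection p \<and> range (\<lambda>v. p *v v) = range (\<lambda>v. q *v v)"
proof -
  define h where "h = (\<lambda>x y :: complex^'n. \<Sum>i\<in>UNIV. x $ i * cnj (y $ i))"
  define S where "S = range (\<lambda>v. q *v v)"
  have addS: "x + y \<in> S" if "x \<in> S" "y \<in> S" for x y
    using that unfolding S_def by (auto simp: matrix_vector_right_distrib[symmetric])
  have scaleS: "c *s x \<in> S" if "x \<in> S" for c x
    using that unfolding S_def by (auto simp: vector_scalar_commute[symmetric])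
  have scaleR: "r *\<^sub>R x = complex_of_real r *s x" for r and x :: "complex^'n"
    by (simp add: vec_eq_iff complex_eq_iff)
  have diffS: "x - y \<in> S" if "x \<in> S" "y \<in> S" for x y
    using addS[OF that(1) scaleS[OF that(2), of "-1"]] by (simp only: vector_sneg_minus1[symmetric] add_uminus_conv_diff)
  have sub: "subspace S"
    unfolding subspace_def using addS scaleS scaleR
    by (auto simp: S_def intro: range_eqI[of _ _ 0])
  have hadd: "h (x + y) z = h x z + h y z" "h (x - y) z = h x z - h y z"
    "h (c *s x) z = c * h x z" "h x (c *s z) = cnj c * h x z" for x y z c
    by (simp_all add: h_def algebra_simps sum.distrib sum_subtractf sum_distrib_left)
  have hcnj: "cnj (h x y) = h y x" for x y
    by (simp add: h_def mult.commute)
  have hself: "x = 0" if "h x x = 0" for x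
    using that inner_complex_vec[of x x] by (simp add: h_def)
  have "\<exists>y. y \<in> S \<and> (\<forall>s\<in>S. h (x - y) s = 0)" for x
  proof -
    obtain y z where y: "y \<in> span S" and z: "\<And>w. w \<in> span S \<Longrightarrow> orthogonal z w"
      and x: "x = y + z"
      using orthogonal_subspace_decomp_exists[of S x] by blast
    have yS: "y \<in> S" using y sub by (simp add: span_eq_iff[THEN iffD2])
    have re: "Re (h z s) = 0" if "s \<in> S" for s
      using z[OF span_base[OF that]] by (simp add: orthogonal_def h_def inner_complex_vec)
    have "h z s = 0" if "s \<in> S" for s
      using re[OF that] re[OF scaleS[OF that, of "\<i>"]] by (simp add: hadd complex_eq_iff)
    with yS x show ?thesis by auto
  qed
  then obtain P where PS: "P x \<in> S" and Po: "s \<in> S \<Longrightarrow> h (x - P x) s = 0" for x s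
    using choice[of "\<lambda>x y. y \<in> S \<and> (\<forall>s\<in>S. h (x - y) s = 0)"] by blast
  have uniq: "y = P x" if "y \<in> S" "\<And>s. s \<in> S \<Longrightarrow> h (x - y) s = 0" for x y
  proof -
    have d: "y - P x \<in> S" using diffS[OF that(1) PS] .
    have "h (y - P x) (y - P x) = 0"
      using that(2)[OF d] Po[OF d, of x] by (simp add: hadd)
    then show ?thesis using hself by force
  qed
  have Pe: "h (P x) s = h x s" if "s \<in> S" for x s
    using Po[OF that, of x] by (simp add: hadd)
  have P_add: "P (x + y) = P x + P y" for x y
    by (rule uniq[symmetric]) (simp_all add: addS PS hadd Pe)
  have P_scale: "P (c *s x) = c *s P x" for c x
    by (rule uniq[symmetric]) (simp_all add: scaleS PS hadd Pe)
  have P_id: "P x = x" if "x \<in> S" for x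
    by (rule uniq[symmetric]) (use that in \<open>auto simp: h_def\<close>)
  have lin: "Vector_Spaces.linear (*s) (*s) P"
    by unfold_locales (simp_all add: P_add P_scale)
  define p where "p = matrix P"
  have pP: "p *v x = P x" for x unfolding p_def by (rule matrix_works[OF lin])
  have "p ** p = p"
    by (simp add: matrix_eq matrix_vector_mul_assoc[symmetric] pP P_id PS)
  moreover have "conjugate_transpose p = p"
  proof -
    have a: "h (P x) y = h x (P y)" for x y
    proof -
      have 1: "h x (P y) = h (P x) (P y)" for x y using Po[OF PS, of x y] by (simp add: hadd)
      have "h (P x) y = cnj (h y (P x))" by (simp only: hcnj)
      also have "\<dots> = cnj (h (P y) (P x))" by (simp only: 1[of y x])
      also have "\<dots> = h x (P y)" by (simp only: hcnj 1[of x y])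
      finally show ?thesis .
    qed
    have b: "h x (axis i 1) = x $ i" for x i
    proof -
      have "h x (axis i 1) = (\<Sum>j\<in>UNIV. if j = i then x $ j else 0)"
        unfolding h_def by (rule sum.cong) (auto simp: axis_def)
      then show ?thesis by simp
    qed
    have "cnj (P (axis i 1) $ j) = P (axis j 1) $ i" for i j
    proof -
      have "P (axis j 1) $ i = h (P (axis j 1)) (axis i 1)" by (simp only: b)
      also have "\<dots> = h (axis j 1) (P (axis i 1))" by (rule a)
      also have "\<dots> = cnj (h (P (axis i 1)) (axis j 1))" by (simp only: hcnj)
      finally show ?thesis by (simp only: b)
    qed
    then show ?thesis
      by (simp add: conjugate_transpose_def p_def matrix_def vec_eq_iff)
  qed
  moreover have "range (\<lambda>v. p *v v) = S"
  proof
    show "range (\<lambda>v. p *v v) \<subseteq> S" using PS by (auto simp: pP)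
    show "S \<subseteq> range (\<lambda>v. p *v v)"
    proof
      fix x assume "x \<in> S"
      then show "x \<in> range (\<lambda>v. p *v v)" using P_id[of x] pP[of x] by (metis rangeI)
    qed
  qed
  ultimately have ex: "\<exists>p. orthogonal_projection p \<and> range (\<lambda>v. p *v v) = range (\<lambda>v. q *v v)"
    unfolding orthogonal_projection_def S_def by blast
  moreover have "p = r" if "orthogonal_projection p \<and> range (\<lambda>v. p *v v) = range (\<lambda>v. q *v v)"
    "orthogonal_projection r \<and> range (\<lambda>v. r *v v) = range (\<lambda>v. q *v v)" for p r
  proof -
    have "p ** r = r" "r ** p = p"
      using that projection_fixes_range[of p r] projection_fixes_range[of r p]
      by (simp_all only: orthogonal_projection_def order_refl)
    then show ?thesis
      using that conjugate_transpose_mult[of p r] by (simp add: orthogonal_projection_def)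
  qed
  ultimately show ?thesis by blast
qed

lemma range_projection:
  "orthogonal_projection (range_projection q)"
  "range (\<lambda>v. range_projection q *v v) = range (\<lambda>v. q *v v)"
  using theI'[OF ex1_range_projection[of q]] by (simp_all add: range_projection_def)

end

theory Submission
  imports Defs "HOL-Computational_Algebra.Polynomial"
begin

text \<open>A diagonal matrix commutes with the range projection of an idempotent \<open>q\<close> iff it leaves the
  range invariant, because invariant subspaces of normal matrices are reducing. By duality the
  commutant condition therefore says that the diagonals of \<open>q y (1 - q)\<close> exhaust all vectors with
  coordinate sum zero. So over a fixed range the idempotents with diagonal \<open>d\<close> form an affine space,
  and the system defining it stays solvable under generic deformations of the range.
  Two idempotents \<open>p\<close>, \<open>q\<close> with equal trace are similar, \<open>q g = g p\<close>. The complex line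
  \<open>(1 - z) 1 + z g\<close> deforms the range of \<open>p\<close> into that of \<open>q\<close>, and the solution of the linear system
  can be followed from either end off finitely many \<open>z\<close>, which do not disconnect the plane. At a
  generic \<open>z\<close> both paths arrive over the same range, where a segment joins them.\<close>

section \<open>Trivial commutants and the diagonals of \<open>q y (1 - q)\<close>\<close>

definition diag_vec :: "'a^'n^'n \<Rightarrow> 'a^'n" where
  "diag_vec x = (\<chi> i. x $ i $ i)"

definition diag_mat :: "('a::zero)^'n \<Rightarrow> 'a^'n^'n" where
  "diag_mat a = (\<chi> i j. if i = j then a $ i else 0)"

section \<open>Identities for matrix products and traces\<close>

lemma matrix_diff_ldistrib: "(A :: 'a::ring_1^'n^'m) ** (B - C) = A ** B - A ** C"
  by (vector matrix_matrix_mult_def sum_subtractf[symmetric] algebra_simps)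

lemma matrix_diff_rdistrib: "((A :: 'a::ring_1^'n^'m) - B) ** C = A ** C - B ** C"
  by (vector matrix_matrix_mult_def sum_subtractf[symmetric] algebra_simps)

lemma matrix_add_rdistrib: "((A :: 'a::semiring_1^'n^'m) + B) ** C = A ** C + B ** C"
  by (vector matrix_matrix_mult_def sum.distrib[symmetric] algebra_simps)

lemmas matrix_algebra = matrix_mul_assoc matrix_diff_ldistrib matrix_diff_rdistrib
  matrix_add_ldistrib matrix_add_rdistrib

lemma matrix_zero_simps [simp]:
  "(0 :: 'a::semiring_1^'n^'m) ** B = 0" "A ** (0 :: 'a::semiring_1^'n^'m) = 0"
  by (simp_all add: matrix_matrix_mult_def vec_eq_iff)

text \<open>Linearity of the map sending \<open>y\<close> to \<open>A ** y ** B\<close>. Scalar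
  combinations of matrices are written entrywise, here and in the uses below.\<close>

lemma matrix_sum_sandwich:
  fixes A B :: "'a::comm_semiring_1^'n^'n"
  shows "A ** (\<chi> k l. \<Sum>i\<in>I. c i * y i $ k $ l) ** B
     = (\<chi> k l. \<Sum>i\<in>I. c i * (A ** y i ** B) $ k $ l)"
proof -
  have "(\<Sum>m\<in>UNIV. (\<Sum>j\<in>UNIV. A $ k $ j * (\<Sum>i\<in>I. c i * y i $ j $ m)) * B $ m $ l)
      = (\<Sum>i\<in>I. c i * (\<Sum>m\<in>UNIV. (\<Sum>j\<in>UNIV. A $ k $ j * y i $ j $ m) * B $ m $ l))" for k l
  proof -
    have "(\<Sum>j\<in>UNIV. A $ k $ j * (\<Sum>i\<in>I. c i * y i $ j $ m))
        = (\<Sum>i\<in>I. c i * (\<Sum>j\<in>UNIV. A $ k $ j * y i $ j $ m))" for m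
      unfolding sum_distrib_left by (subst sum.swap) (simp add: ac_simps)
    then have "(\<Sum>m\<in>UNIV. (\<Sum>j\<in>UNIV. A $ k $ j * (\<Sum>i\<in>I. c i * y i $ j $ m)) * B $ m $ l)
      = (\<Sum>m\<in>UNIV. \<Sum>i\<in>I. c i * ((\<Sum>j\<in>UNIV. A $ k $ j * y i $ j $ m) * B $ m $ l))"
      by (simp add: sum_distrib_right mult.assoc)
    then show ?thesis
      unfolding sum_distrib_left by (subst (asm) sum.swap) simp
  qed
  then show ?thesis by (simp add: matrix_matrix_mult_def vec_eq_iff)
qed

lemma trace_diag_mat_mult: "trace (diag_mat a ** x) = (\<Sum>i\<in>UNIV. a $ i * x $ i $ i)"
  for x :: "'a::comm_semiring_1^'n^'n"
proof -
  have "(\<Sum>j\<in>UNIV. (if i = j then a $ i else 0) * x $ j $ i) = a $ i * x $ i $ i" for i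
    by (subst sum.remove[of _ i]) (auto intro!: sum.neutral)
  then show ?thesis by (simp add: trace_def diag_mat_def matrix_matrix_mult_def)
qed

section \<open>Invariant subspaces of normal matrices and range projections\<close>

lemma conjugate_transpose_diff:
  "conjugate_transpose (x - y) = conjugate_transpose x - conjugate_transpose y"
  by (simp add: conjugate_transpose_def vec_eq_iff)

text \<open>The trace is the sum of the squared moduli of the entries, the squared Frobenius norm of
  \<open>b\<close>.\<close>

lemma trace_mult_conjugate_transpose_eq_0:
  assumes "trace (b ** conjugate_transpose b) = 0"
  shows "b = 0"
proof -
  have "trace (b ** conjugate_transpose b)
      = complex_of_real (\<Sum>i\<in>UNIV. \<Sum>j\<in>UNIV. (cmod (b $ i $ j))\<^sup>2)"
    by (simp add: trace_def matrix_matrix_mult_def conjugate_transpose_def complex_norm_square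
        del: of_real_power)
  then have "(\<Sum>i\<in>UNIV. \<Sum>j\<in>UNIV. (cmod (b $ i $ j))\<^sup>2) = 0" using assms by (metis of_real_eq_0_iff)
  then have "\<forall>i j. (cmod (b $ i $ j))\<^sup>2 = 0"
    by (simp add: sum_nonneg_eq_0_iff sum_nonneg)
  then show ?thesis by (simp add: vec_eq_iff)
qed

text \<open>The commutator \<open>b\<close> of \<open>p\<close> and \<open>a\<close> has Frobenius
  norm zero: invariance reduces \<open>b ** conjugate_transpose b\<close> to a difference of two
  terms, whose traces agree by cyclicity and normality.\<close>

lemma normal_invariant_imp_commute:
  assumes p: "orthogonal_projection p"
    and normal: "a ** conjugate_transpose a = conjugate_transpose a ** a"
    and inv: "a ** p = p ** a ** p"
  shows "p ** a = a ** p"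
proof -
  let ?s = "conjugate_transpose a"
  have pp: "p ** p = p" and ps: "conjugate_transpose p = p"
    using p by (auto simp: orthogonal_projection_def)
  have inv': "p ** ?s = p ** ?s ** p"
    using arg_cong[OF inv, of conjugate_transpose]
    by (simp add: conjugate_transpose_mult ps matrix_mul_assoc)
  define b where "b = p ** a - a ** p"
  have "conjugate_transpose b = ?s ** p - p ** ?s"
    unfolding b_def by (simp add: conjugate_transpose_diff conjugate_transpose_mult ps)
  then have "b ** conjugate_transpose b
      = p ** a ** ?s ** p - p ** a ** p ** ?s - a ** (p ** ?s ** p) + a ** (p ** p) ** ?s"
    unfolding b_def by (simp add: matrix_algebra)
  also have "\<dots> = p ** a ** ?s ** p - a ** p ** ?s"
    by (simp add: pp inv[symmetric] inv'[symmetric] matrix_mul_assoc)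
  finally have "b ** conjugate_transpose b = p ** (a ** ?s ** p) - a ** (p ** ?s)"
    by (simp add: matrix_mul_assoc)
  moreover have "trace (p ** (a ** ?s ** p)) = trace (a ** (p ** ?s))"
  proof -
    have "trace (p ** (a ** ?s ** p)) = trace (a ** ?s ** p ** p)"
      by (rule trace_mul_sym)
    also have "\<dots> = trace (a ** ?s ** p)" by (simp add: pp flip: matrix_mul_assoc)
    also have "\<dots> = trace (p ** (?s ** a))"
      by (simp add: normal) (rule trace_mul_sym)
    also have "\<dots> = trace (a ** (p ** ?s))"
      by (simp only: matrix_mul_assoc trace_mul_sym[of "p ** ?s" a])
    finally show ?thesis .
  qed
  ultimately have "trace (b ** conjugate_transpose b) = 0" by (simp add: trace_sub)
  from trace_mult_conjugate_transpose_eq_0[OF this] show ?thesis by (simp add: b_def)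
qed

text \<open>An idempotent fixes exactly the vectors in its range. The algebraic form on the right
  replaces equality of ranges from here on.\<close>

lemma same_range_iff:
  fixes p q :: "complex^'n^'n"
  assumes "p ** p = p" "q ** q = q"
  shows "range (\<lambda>v. p *v v) = range (\<lambda>v. q *v v) \<longleftrightarrow> p ** q = q \<and> q ** p = p"
proof
  assume "range (\<lambda>v. p *v v) = range (\<lambda>v. q *v v)"
  then show "p ** q = q \<and> q ** p = p"
    using projection_fixes_range[of p q] projection_fixes_range[of q p] assms by simp
next
  assume "p ** q = q \<and> q ** p = p"
  then have "q *v v = p *v (q *v v)" "p *v v = q *v (p *v v)" for v
    by (simp_all add: matrix_vector_mul_assoc)
  then show "range (\<lambda>v. p *v v) = range (\<lambda>v. q *v v)"
    by (metis (no_types, lifting) image_subset_iff rangeI subset_antisym)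
qed

lemma diag_mat_normal:
  "diag_mat a ** conjugate_transpose (diag_mat a) = conjugate_transpose (diag_mat a) ** diag_mat a"
  by (auto simp: diag_mat_def conjugate_transpose_def matrix_matrix_mult_def vec_eq_iff intro!: sum.cong)

text \<open>Commuting with the range projection amounts to leaving the range invariant, since
  diagonal matrices are normal, and invariance can be tested with any idempotent having that range,
  in particular with \<open>q\<close>.\<close>

lemma commutant_range_projection_diag_mat:
  assumes "q ** q = q"
  shows "diag_mat a \<in> commutant (range_projection q) \<longleftrightarrow> (mat 1 - q) ** diag_mat a ** q = 0"
proof -
  let ?p = "range_projection q" and ?a = "diag_mat a"
  have p: "orthogonal_projection ?p" and pp: "?p ** ?p = ?p"
    using range_projection(1)[of q] by (auto simp: orthogonal_projection_def)
  have pq: "?p ** q = q" and qp: "q ** ?p = ?p"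
    using range_projection(2)[of q] same_range_iff[OF pp assms] by auto
  have "?p ** ?a = ?a ** ?p \<longleftrightarrow> ?a ** q = q ** ?a ** q"
  proof
    assume comm: "?p ** ?a = ?a ** ?p"
    have "?a ** q = ?a ** ?p ** q" by (simp add: pq flip: matrix_mul_assoc)
    also have "\<dots> = q ** ?p ** ?a ** q" by (simp add: comm[symmetric] qp)
    also have "\<dots> = q ** (?p ** ?a) ** q" by (simp add: matrix_mul_assoc)
    also have "\<dots> = q ** ?a ** (?p ** q)" by (simp add: comm matrix_mul_assoc)
    finally show "?a ** q = q ** ?a ** q" by (simp add: pq)
  next
    assume inv: "?a ** q = q ** ?a ** q"
    have "?a ** ?p = ?a ** q ** ?p" by (simp add: qp flip: matrix_mul_assoc)
    also have "\<dots> = q ** ?a ** q ** ?p" by (simp add: inv)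
    also have "\<dots> = q ** ?a ** ?p" by (simp add: qp flip: matrix_mul_assoc)
    finally have 1: "?a ** ?p = q ** ?a ** ?p" .
    have "?p ** ?a ** ?p = ?p ** (q ** ?a ** ?p)" by (simp add: 1[symmetric] matrix_mul_assoc)
    also have "\<dots> = q ** ?a ** ?p" by (simp add: matrix_mul_assoc pq)
    finally have "?a ** ?p = ?p ** ?a ** ?p" by (simp add: 1[symmetric])
    from normal_invariant_imp_commute[OF p diag_mat_normal this] show "?p ** ?a = ?a ** ?p" .
  qed
  then show ?thesis by (simp add: commutant_def matrix_diff_rdistrib)
qed

section \<open>Diagonal matrices, scalars and duality\<close>

lemma diagonal_algebra_eq: "diagonal_algebra = range diag_mat"
proof -
  have "x = diag_mat (diag_vec x)" if "x \<in> diagonal_algebra" for x :: "complex^'n^'n"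
    using that by (auto simp: diagonal_algebra_def diag_mat_def diag_vec_def vec_eq_iff)
  then show ?thesis by (auto simp: diagonal_algebra_def diag_mat_def)
qed

lemma diag_mat_scalar_iff: "diag_mat a \<in> scalar_matrices \<longleftrightarrow> (\<forall>i j. a $ i = a $ j)"
proof
  assume "diag_mat a \<in> scalar_matrices"
  then obtain c where "diag_mat a = mat c" by (auto simp: scalar_matrices_def)
  then have "a $ i = c" for i by (simp add: diag_mat_def mat_def vec_eq_iff) metis
  then show "\<forall>i j. a $ i = a $ j" by simp
next
  assume "\<forall>i j. a $ i = a $ j"
  then have "diag_mat a = mat (a $ undefined)" by (auto simp: diag_mat_def mat_def vec_eq_iff)
  then show "diag_mat a \<in> scalar_matrices" by (auto simp: scalar_matrices_def)
qed

lemma scalar_subset_commutant: "scalar_matrices \<subseteq> commutant x \<inter> diagonal_algebra"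
proof -
  have "x ** mat c = mat c ** x" for c and x :: "complex^'n^'n"
    by (simp add: matrix_matrix_mult_def mat_def vec_eq_iff if_distrib if_distribR mult.commute
        cong: if_cong)
  then show ?thesis
    by (auto simp: scalar_matrices_def commutant_def diagonal_algebra_def mat_def)
qed

text \<open>Applying real orthogonality to \<open>w\<close> and to \<open>\<i> w\<close> makes the real and the imaginary
  part of the hermitian product vanish.\<close>

lemma complex_subspace_annihilator:
  fixes S :: "(complex^'n) set"
  assumes add: "\<And>x y. x \<in> S \<Longrightarrow> y \<in> S \<Longrightarrow> x + y \<in> S"
    and scale: "\<And>c x. x \<in> S \<Longrightarrow> c *s x \<in> S"
    and "0 \<in> S" "v \<notin> S"
  obtains a where "\<And>w. w \<in> S \<Longrightarrow> (\<Sum>i\<in>UNIV. a $ i * w $ i) = 0" "(\<Sum>i\<in>UNIV. a $ i * v $ i) \<noteq> 0"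
proof -
  have scaleR: "r *\<^sub>R x = complex_of_real r *s x" for r and x :: "complex^'n"
    by (simp add: vec_eq_iff complex_eq_iff)
  have sub: "subspace S"
    unfolding subspace_def using assms by (auto simp: scaleR)
  obtain y z where y: "y \<in> span S" and z: "\<And>w. w \<in> span S \<Longrightarrow> orthogonal z w"
    and v: "v = y + z"
    using orthogonal_subspace_decomp_exists[of S v] by blast
  have yS: "y \<in> S" using y sub by (simp add: span_eq_iff[THEN iffD2])
  \<comment> \<open>The functional has the conjugated coordinates of \<open>z\<close>, the component
    of \<open>v\<close> orthogonal to \<open>S\<close>: the bilinear sum is then the hermitian
    product of \<open>w\<close> with \<open>z\<close>.\<close>
  have re: "Re (\<Sum>i\<in>UNIV. cnj (z $ i) * w $ i) = 0" if "w \<in> S" for w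
    using z[OF span_base[OF that]]
    by (simp add: orthogonal_def inner_complex_vec mult.commute)
  have ann: "(\<Sum>i\<in>UNIV. cnj (z $ i) * w $ i) = 0" if "w \<in> S" for w
  proof -
    have "Re (\<i> * (\<Sum>i\<in>UNIV. cnj (z $ i) * w $ i)) = 0"
      using re[OF scale[OF that, of "\<i>"]] by (simp only: vector_smult_component sum_distrib_left ac_simps)
    then show ?thesis using re[OF that] by (simp add: complex_eq_iff)
  qed
  have "z \<noteq> 0" using \<open>v \<notin> S\<close> yS v by auto
  moreover have "Re (\<Sum>i\<in>UNIV. cnj (z $ i) * z $ i) = z \<bullet> z"
    by (simp add: inner_complex_vec mult.commute)
  ultimately have "(\<Sum>i\<in>UNIV. cnj (z $ i) * z $ i) \<noteq> 0"
    by (metis inner_eq_zero_iff zero_complex.simps(1))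
  then have "(\<Sum>i\<in>UNIV. cnj (z $ i) * v $ i) \<noteq> 0"
    using ann[OF yS] by (simp add: v distrib_left sum.distrib)
  with ann that[of "\<chi> i. cnj (z $ i)"] show ?thesis by simp
qed

text \<open>The matrix \<open>q ** y ** (mat 1 - q)\<close> has trace zero for idempotent
  \<open>q\<close>, so its diagonal cannot reach more than the vectors named here. Adding such a
  matrix to \<open>q\<close> gives the idempotents with the same range.\<close>

definition traceless_surj :: "complex^'n^'n \<Rightarrow> bool" where
  "traceless_surj q \<longleftrightarrow>
     (\<forall>v. (\<Sum>i\<in>UNIV. v $ i) = 0 \<longrightarrow> (\<exists>y. diag_vec (q ** y ** (mat 1 - q)) = v))"

text \<open>Under the trace pairing, the annihilator of the space of all diagonals of
  \<open>q ** y ** (mat 1 - q)\<close> consists of the \<open>a\<close> with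
  \<open>(mat 1 - q) ** diag_mat a ** q = 0\<close>. It contains only constant vectors iff the space
  contains all vectors of sum zero.\<close>

lemma trivial_commutant_iff_traceless_surj:
  fixes q :: "complex^'n^'n"
  assumes q: "q ** q = q"
  shows "commutant (range_projection q) \<inter> diagonal_algebra = scalar_matrices \<longleftrightarrow> traceless_surj q"
proof -
  have pairing: "(\<Sum>i\<in>UNIV. a $ i * diag_vec (q ** y ** (mat 1 - q)) $ i)
      = trace (((mat 1 - q) ** diag_mat a ** q) ** y)" for a y
  proof -
    have "(\<Sum>i\<in>UNIV. a $ i * diag_vec (q ** y ** (mat 1 - q)) $ i)
        = trace ((diag_mat a ** q ** y) ** (mat 1 - q))"
      by (simp add: trace_diag_mat_mult diag_vec_def flip: matrix_mul_assoc)
    also have "\<dots> = trace ((mat 1 - q) ** (diag_mat a ** q ** y))" by (rule trace_mul_sym)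
    finally show ?thesis by (simp add: matrix_mul_assoc)
  qed
  have triv: "commutant (range_projection q) \<inter> diagonal_algebra = scalar_matrices \<longleftrightarrow>
      (\<forall>a. (mat 1 - q) ** diag_mat a ** q = 0 \<longrightarrow> (\<forall>i j. a $ i = a $ j))"
    using scalar_subset_commutant[of "range_projection q"]
    unfolding diagonal_algebra_eq commutant_range_projection_diag_mat[OF q, symmetric]
      diag_mat_scalar_iff[symmetric] by blast
  show ?thesis
    unfolding triv
  proof
    assume const: "\<forall>a. (mat 1 - q) ** diag_mat a ** q = 0 \<longrightarrow> (\<forall>i j. a $ i = a $ j)"
    define S where "S = range (\<lambda>y. diag_vec (q ** y ** (mat 1 - q)))"
    have "v \<in> S" if v: "(\<Sum>i\<in>UNIV. v $ i) = 0" for v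
    proof (rule ccontr)
      assume "v \<notin> S"
      have add: "x + y \<in> S" if "x \<in> S" "y \<in> S" for x y
      proof -
        from that obtain a b where "x = diag_vec (q ** a ** (mat 1 - q))"
          "y = diag_vec (q ** b ** (mat 1 - q))" by (auto simp: S_def)
        then have "x + y = diag_vec (q ** (a + b) ** (mat 1 - q))"
          by (simp add: matrix_add_ldistrib matrix_add_rdistrib diag_vec_def vec_eq_iff)
        then show ?thesis by (auto simp: S_def)
      qed
      have scale: "c *s x \<in> S" if "x \<in> S" for c x
      proof -
        from that obtain a where "x = diag_vec (q ** a ** (mat 1 - q))" by (auto simp: S_def)
        then have "c *s x = diag_vec (q ** (\<chi> k l. c * a $ k $ l) ** (mat 1 - q))"
          using matrix_sum_sandwich[of q "\<lambda>_. c" "\<lambda>_. a" "{()}" "mat 1 - q"]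
          by (simp add: diag_vec_def vec_eq_iff)
        then show ?thesis by (auto simp: S_def)
      qed
      have "0 \<in> S" by (auto simp: S_def diag_vec_def vec_eq_iff intro!: range_eqI[of _ _ 0])
      from complex_subspace_annihilator[OF add scale this \<open>v \<notin> S\<close>]
      obtain a where ann: "\<And>w. w \<in> S \<Longrightarrow> (\<Sum>i\<in>UNIV. a $ i * w $ i) = 0"
        and av: "(\<Sum>i\<in>UNIV. a $ i * v $ i) \<noteq> 0" by blast
      have "trace (((mat 1 - q) ** diag_mat a ** q) ** y) = 0" for y
        using ann[of "diag_vec (q ** y ** (mat 1 - q))"] pairing[of a y] by (simp add: S_def)
      \<comment> \<open>Taking for \<open>y\<close> the conjugate transpose of this matrix turns the
        trace into its squared Frobenius norm.\<close>
      then have "(mat 1 - q) ** diag_mat a ** q = 0"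
        by (rule trace_mult_conjugate_transpose_eq_0)
      with const obtain c where "\<And>i. a $ i = c" by metis
      then have "(\<Sum>i\<in>UNIV. a $ i * v $ i) = c * (\<Sum>i\<in>UNIV. v $ i)"
        by (simp add: sum_distrib_left)
      with av v show False by simp
    qed
    then show "traceless_surj q" unfolding traceless_surj_def S_def by fastforce
  next
    assume surj: "traceless_surj q"
    show "\<forall>a. (mat 1 - q) ** diag_mat a ** q = 0 \<longrightarrow> (\<forall>i j. a $ i = a $ j)"
    proof (intro allI impI)
      fix a i j assume a: "(mat 1 - q) ** diag_mat a ** q = 0"
      \<comment> \<open>Pairing \<open>a\<close> with this vector of sum zero yields
        \<open>a $ i - a $ j\<close>.\<close>
      define v :: "complex^'n" where "v = axis i 1 - axis j 1"
      have "(\<Sum>k\<in>UNIV. v $ k) = 0" by (simp add: v_def axis_def sum_subtractf)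
      then obtain y where "diag_vec (q ** y ** (mat 1 - q)) = v"
        using surj by (auto simp: traceless_surj_def)
      then have "(\<Sum>k\<in>UNIV. a $ k * v $ k) = 0" using pairing[of a y] a by (simp add: trace_def)
      moreover have "(\<Sum>k\<in>UNIV. a $ k * v $ k)
          = (\<Sum>k\<in>UNIV. if k = i then a $ i else 0) - (\<Sum>k\<in>UNIV. if k = j then a $ j else 0)"
        unfolding sum_subtractf[symmetric] by (rule sum.cong) (auto simp: v_def axis_def)
      ultimately show "a $ i = a $ j" by simp
    qed
  qed
qed

section \<open>Similarity of idempotents with equal trace\<close>

text \<open>Serves to index an eigenbasis \<open>B\<close> by \<open>'n\<close> so that the
  eigenvectors for eigenvalue 1 occupy a prescribed set \<open>S\<close> of columns.\<close>

lemma bij_extending_equinumerous: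
  fixes S :: "'n::finite set"
  assumes "finite B" "card B = CARD('n)" "A \<subseteq> B" "card S = card A"
  obtains f :: "'n \<Rightarrow> 'b" where "bij_betw f UNIV B" "f ` S = A"
proof -
  have "finite A" using assms finite_subset by blast
  then obtain g where g: "bij_betw g S A" using assms by (metis finite finite_same_card_bij)
  have "card (- S) = card (B - A)"
    using assms \<open>finite A\<close> by (simp add: Compl_eq_Diff_UNIV card_Diff_subset)
  then obtain g' where g': "bij_betw g' (- S) (B - A)"
    using assms by (metis finite finite_Diff finite_same_card_bij)
  define f where "f = (\<lambda>x. if x \<in> S then g x else g' x)"
  have 1: "bij_betw f S A" using g bij_betw_cong[of S f g] by (simp add: f_def)
  have 2: "bij_betw f (- S) (B - A)" using g' bij_betw_cong[of "- S" f g'] by (simp add: f_def)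
  have "bij_betw f (S \<union> - S) (A \<union> (B - A))" by (rule bij_betw_combine[OF 1 2]) auto
  moreover have "f ` S = A" using 1 by (simp add: bij_betw_def)
  ultimately show ?thesis using that[of f] assms(3) by (simp add: Un_absorb1)
qed

lemma mult_diag_mat_nth: "(A ** diag_mat a) $ i $ j = A $ i $ j * a $ j"
  for A :: "'a::semiring_1^'n^'m"
proof -
  have "(\<Sum>k\<in>UNIV. A $ i $ k * (if k = j then a $ k else 0))
      = (\<Sum>k\<in>UNIV. if k = j then A $ i $ j * a $ j else 0)"
    by (rule sum.cong) auto
  then show ?thesis by (simp add: matrix_matrix_mult_def diag_mat_def)
qed

text \<open>The number \<open>k\<close> is the rank. The set \<open>S\<close> is left arbitrary so
  that two idempotents of equal rank can be brought to the very same diagonal matrix.\<close>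

lemma idempotent_diagonalize:
  fixes q :: "'a::field^'n^'n"
  assumes q: "q ** q = q"
  obtains k where "k \<le> CARD('n)"
    "\<forall>S :: 'n set. card S = k \<longrightarrow>
       (\<exists>P. invertible P \<and> q ** P = P ** diag_mat (\<chi> i. if i \<in> S then 1 else 0))"
proof -
  \<comment> \<open>The eigenvectors for 1 and 0 (and the zero vector). They span the space because
    \<open>x\<close> is the sum of \<open>q *v x\<close> and \<open>x - q *v x\<close>, so a maximal
    independent subset is an eigenbasis.\<close>
  define V where "V = {x. q *v x = x} \<union> {x. q *v x = 0}"
  obtain B where BV: "B \<subseteq> V" and ind: "vec.independent B" and span: "V \<subseteq> vec.span B"
    by (rule vec.maximal_independent_subset)
  have "x \<in> vec.span B" for x
  proof -
    have "q *v x \<in> V" "x - q *v x \<in> V"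
      using q by (simp_all add: V_def matrix_vector_mul_assoc matrix_vector_mult_diff_distrib)
    then have "q *v x + (x - q *v x) \<in> vec.span B" using span by (intro vec.span_add) auto
    then show ?thesis by simp
  qed
  then have spanB: "vec.span B = UNIV" by auto
  have fin: "finite B" using ind by (rule vec.finiteI_independent)
  have cardB: "card B = CARD('n)"
    using vec.dim_eq_card[OF _ ind, of UNIV] spanB by (simp add: vec.dim_UNIV vec.dimension_def card_cart_basis)
  define A where "A = {x \<in> B. q *v x = x}"
  have AB: "A \<subseteq> B" by (auto simp: A_def)
  show ?thesis
  proof (rule that[of "card A"], goal_cases)
    case 1
    show ?case using card_mono[OF fin AB] cardB by simp
  next
    case 2
    show ?case
    proof (intro allI impI)
      fix S :: "'n set" assume "card S = card A"
      from bij_extending_equinumerous[OF fin cardB AB this]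
      obtain f where bij: "bij_betw f UNIV B" and fS: "f ` S = A" .
      define P where "P = (\<chi> i j. f j $ i)"
      have col: "column j P = f j" for j by (simp add: P_def column_def)
      have inj: "inj f" and fB: "range f = B" using bij by (auto simp: bij_betw_def)
      have "invertible P"
        unfolding invertible_left_inverse matrix_left_invertible_independent_columns
      proof (intro allI impI)
        fix c i assume c: "(\<Sum>i\<in>UNIV. c i *s column i P) = 0"
        have "(\<Sum>x\<in>B. c (the_inv f x) *s x) = (\<Sum>i\<in>UNIV. c i *s f i)"
          unfolding fB[symmetric] by (subst sum.reindex[OF inj]) (simp add: the_inv_f_f inj)
        then have "(\<Sum>x\<in>B. c (the_inv f x) *s x) = 0" using c by (simp add: col)
        then have "c (the_inv f (f i)) = 0"
          using ind fin fB unfolding vec.independent_explicit_finite_subsets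
          by (auto dest!: spec[of _ B] spec[of _ "\<lambda>x. c (the_inv f x)"])
        then show "c i = 0" by (simp add: the_inv_f_f inj)
      qed
      moreover have "q ** P = P ** diag_mat (\<chi> i. if i \<in> S then 1 else 0)"
      proof -
        have qf: "q *v f j = (if j \<in> S then f j else 0)" for j
        proof (cases "j \<in> S")
          case True
          then have "f j \<in> A" using fS by blast
          then show ?thesis using True by (simp add: A_def)
        next
          case False
          then have "f j \<notin> A" using fS inj by (metis image_iff inj_eq)
          moreover have "f j \<in> B" using fB by blast
          ultimately show ?thesis using False BV by (auto simp: A_def V_def)
        qed
        have "(q ** P) $ i $ j = (q *v f j) $ i" for i j
          by (simp add: P_def matrix_matrix_mult_def matrix_vector_mult_def)
        moreover have "(P ** diag_mat (\<chi> i. if i \<in> S then 1 else 0)) $ i $ j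
            = (if j \<in> S then f j else 0) $ i" for i j
          by (simp add: mult_diag_mat_nth P_def)
        ultimately show ?thesis by (simp add: vec_eq_iff qf)
      qed
      ultimately show "\<exists>P. invertible P \<and> q ** P = P ** diag_mat (\<chi> i. if i \<in> S then 1 else 0)"
        by blast
    qed
  qed
qed

lemma matrix_inv_works:
  assumes "invertible A"
  shows "A ** matrix_inv A = mat 1" "matrix_inv A ** A = mat 1"
  using someI_ex[OF assms[unfolded invertible_def]] by (simp_all add: matrix_inv_def)

lemma trace_conjugate:
  fixes P :: "'a::comm_semiring_1^'n^'n"
  assumes "A ** P = P ** D" "P ** R = mat 1" "R ** P = mat 1"
  shows "trace A = trace D"
proof -
  have "A = A ** (P ** R)" by (simp add: assms)
  also have "\<dots> = P ** (D ** R)" by (simp add: assms(1) matrix_mul_assoc)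
  finally have "trace A = trace ((D ** R) ** P)" using trace_mul_sym by metis
  also have "\<dots> = trace D" by (simp add: assms flip: matrix_mul_assoc)
  finally show ?thesis .
qed

lemma trace_diag_indicator: "trace (diag_mat (\<chi> i. if i \<in> S then 1 else 0)) = of_nat (card S)"
  by (simp add: trace_def diag_mat_def sum.If_cases)

text \<open>In characteristic zero the trace determines the rank, hence the diagonal form shared by
  both idempotents.\<close>

lemma idempotents_similar:
  fixes p q :: "'a::field_char_0^'n^'n"
  assumes "p ** p = p" "q ** q = q" "trace p = trace q"
  obtains g where "invertible g" "q ** g = g ** p"
proof -
  obtain k where k: "k \<le> CARD('n)" "\<forall>S :: 'n set. card S = k \<longrightarrow>
      (\<exists>P. invertible P \<and> p ** P = P ** diag_mat (\<chi> i. if i \<in> S then 1 else 0))"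
    by (rule idempotent_diagonalize[OF assms(1)])
  obtain l where l: "l \<le> CARD('n)" "\<forall>S :: 'n set. card S = l \<longrightarrow>
      (\<exists>P. invertible P \<and> q ** P = P ** diag_mat (\<chi> i. if i \<in> S then 1 else 0))"
    by (rule idempotent_diagonalize[OF assms(2)])
  obtain S :: "'n set" where S: "card S = k" using obtain_subset_with_card_n[OF k(1)] by metis
  obtain T :: "'n set" where T: "card T = l" using obtain_subset_with_card_n[OF l(1)] by metis
  let ?D = "\<lambda>S. diag_mat (\<chi> i. if i \<in> S then 1 else 0) :: 'a^'n^'n"
  from k(2) S obtain P where P: "invertible P" "p ** P = P ** ?D S" by blast
  from l(2) T obtain Q where "invertible Q" "q ** Q = Q ** ?D T" by blast
  then have "trace q = of_nat l"
    using trace_conjugate[OF _ matrix_inv_works] trace_diag_indicator T by metis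
  moreover have "trace p = of_nat k"
    using P trace_conjugate[OF _ matrix_inv_works] trace_diag_indicator S by metis
  ultimately have "k = l" using assms(3) by simp
  \<comment> \<open>The earlier \<open>Q\<close> belonged to \<open>T\<close> and only gave the
    trace of \<open>q\<close>; now that \<open>k = l\<close>, one is chosen for the set
    \<open>S\<close> used by \<open>P\<close>.\<close>
  with l(2) S obtain Q where Q: "invertible Q" "q ** Q = Q ** ?D S" by blast
  note Pi = matrix_inv_works[OF P(1)]
  define g where "g = Q ** matrix_inv P"
  have "invertible (matrix_inv P)" using Pi by (auto simp: invertible_def)
  then have "invertible g" using Q(1) by (simp add: g_def invertible_mult)
  moreover have "q ** g = g ** p"
  proof -
    have "?D S = matrix_inv P ** (P ** ?D S)" by (simp add: Pi matrix_mul_assoc)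
    then have "?D S ** matrix_inv P = matrix_inv P ** p ** P ** matrix_inv P"
      by (simp add: P(2)[symmetric] matrix_mul_assoc)
    also have "\<dots> = matrix_inv P ** p" by (simp add: Pi flip: matrix_mul_assoc)
    finally show ?thesis unfolding g_def
      by (simp add: matrix_mul_assoc Q(2)) (simp flip: matrix_mul_assoc)
  qed
  ultimately show ?thesis by (rule that)
qed

section \<open>Polynomial families of matrices\<close>

text \<open>Polynomials are treated as functions, so that entries of matrix products and
  determinants can be handled by value. What matters later is that they are continuous and have
  finitely many zeros unless they vanish identically.\<close>

definition poly_fun :: "('a::comm_ring_1 \<Rightarrow> 'a) \<Rightarrow> bool" where
  "poly_fun f \<longleftrightarrow> (\<exists>p. f = poly p)"

lemma poly_fun_const [intro, simp]: "poly_fun (\<lambda>_. c)"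
  unfolding poly_fun_def by (rule exI[of _ "[:c:]"]) auto

lemma poly_fun_ident [intro, simp]: "poly_fun (\<lambda>z. z)"
  unfolding poly_fun_def by (rule exI[of _ "[:0, 1:]"]) auto

lemma poly_fun_add [intro]: "poly_fun f \<Longrightarrow> poly_fun g \<Longrightarrow> poly_fun (\<lambda>z. f z + g z)"
  by (auto simp: poly_fun_def fun_eq_iff simp flip: poly_add)

lemma poly_fun_diff [intro]: "poly_fun f \<Longrightarrow> poly_fun g \<Longrightarrow> poly_fun (\<lambda>z. f z - g z)"
  by (auto simp: poly_fun_def fun_eq_iff simp flip: poly_diff)

lemma poly_fun_mult [intro]: "poly_fun f \<Longrightarrow> poly_fun g \<Longrightarrow> poly_fun (\<lambda>z. f z * g z)"
  by (auto simp: poly_fun_def fun_eq_iff simp flip: poly_mult)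

lemma poly_fun_sum [intro]: "(\<And>i. i \<in> I \<Longrightarrow> poly_fun (f i)) \<Longrightarrow> poly_fun (\<lambda>z. \<Sum>i\<in>I. f i z)"
  by (induction I rule: infinite_finite_induct) (auto intro: poly_fun_add)

lemma poly_fun_prod [intro]: "(\<And>i. i \<in> I \<Longrightarrow> poly_fun (f i)) \<Longrightarrow> poly_fun (\<lambda>z. \<Prod>i\<in>I. f i z)"
  by (induction I rule: infinite_finite_induct) (auto intro: poly_fun_mult)

lemma poly_fun_det:
  assumes "\<And>i j. poly_fun (\<lambda>z. A z $ i $ j)"
  shows "poly_fun (\<lambda>z. det (A z))"
  unfolding det_def by (intro poly_fun_sum poly_fun_mult poly_fun_prod poly_fun_const assms)

lemma poly_fun_matrix_mult:
  assumes "\<And>i j. poly_fun (\<lambda>z. A z $ i $ j)" "\<And>i j. poly_fun (\<lambda>z. B z $ i $ j)"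
  shows "poly_fun (\<lambda>z. (A z ** B z) $ i $ j)"
  unfolding matrix_matrix_mult_def by (simp add: poly_fun_sum poly_fun_mult assms)

lemma finite_zeros_poly_fun:
  fixes f :: "'a::idom \<Rightarrow> 'a"
  assumes "poly_fun f" "f z0 \<noteq> 0"
  shows "finite {z. f z = 0}"
proof -
  obtain p where p: "f = poly p" using assms by (auto simp: poly_fun_def)
  with assms(2) have "p \<noteq> 0" by auto
  then show ?thesis unfolding p by (rule poly_roots_finite)
qed

lemma continuous_on_poly_fun:
  fixes f :: "'a::real_normed_field \<Rightarrow> 'a"
  shows "poly_fun f \<Longrightarrow> continuous_on S f"
  by (auto simp: poly_fun_def intro: continuous_intros)

text \<open>Each entry is a numerator of Cramer's rule: column \<open>k\<close> is replaced by the
  unit vector \<open>axis i 1\<close>. Unlike the inverse, it is polynomial in the entries of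
  \<open>A\<close>.\<close>

definition adjugate :: "'a::comm_ring_1^'n^'n \<Rightarrow> 'a^'n^'n" where
  "adjugate A = (\<chi> k i. det (\<chi> a b. if b = k then axis i 1 $ a else A $ a $ b))"

lemma matrix_inv_nth:
  fixes A :: "'a::field^'n^'n"
  assumes "det A \<noteq> 0"
  shows "matrix_inv A $ k $ i = adjugate A $ k $ i / det A"
proof -
  have inv: "invertible A" using assms by (simp add: invertible_det_nz)
  have "A *v (matrix_inv A *v axis i 1) = axis i 1"
    by (simp add: matrix_vector_mul_assoc matrix_inv_works[OF inv])
  then have "(matrix_inv A *v axis i 1) $ k = adjugate A $ k $ i / det A"
    unfolding cramer[OF assms] by (simp add: adjugate_def)
  moreover have "(\<Sum>j\<in>UNIV. B $ k $ j * axis i 1 $ j) = B $ k $ i" for B :: "'a^'n^'n"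
    by (simp add: axis_def if_distrib cong: if_cong)
  ultimately show ?thesis by (simp add: matrix_vector_mult_def)
qed

text \<open>Clears the denominator of the inverse, so that a system containing
  \<open>matrix_inv A\<close> becomes polynomial.\<close>

lemma mult_adjugate_nth:
  fixes A :: "'a::field^'n^'n"
  assumes "det A \<noteq> 0"
  shows "(B ** adjugate A) $ k $ i = det A * (B ** matrix_inv A) $ k $ i"
  using assms by (simp add: matrix_matrix_mult_def matrix_inv_nth sum_distrib_left)

lemma poly_fun_adjugate:
  assumes "\<And>i j. poly_fun (\<lambda>z. A z $ i $ j)"
  shows "poly_fun (\<lambda>z. adjugate (A z) $ i $ j)"
  unfolding adjugate_def vec_lambda_beta
proof (rule poly_fun_det)
  fix a b
  show "poly_fun (\<lambda>z. (\<chi> a b. if b = i then axis j 1 $ a else A z $ a $ b) $ a $ b)"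
    by (cases "b = i") (simp_all add: assms)
qed

section \<open>Continuity of determinants, products and inverses\<close>

lemma continuous_on_det:
  fixes A :: "'b::topological_space \<Rightarrow> 'a::real_normed_field^'n^'n"
  assumes "\<And>i j. continuous_on S (\<lambda>z. A z $ i $ j)"
  shows "continuous_on S (\<lambda>z. det (A z))"
  unfolding det_def by (intro continuous_intros assms)

lemma continuous_on_matrix_mult [continuous_intros]:
  fixes A B :: "'b::topological_space \<Rightarrow> 'a::real_normed_field^'n^'n"
  assumes "continuous_on S A" "continuous_on S B"
  shows "continuous_on S (\<lambda>z. A z ** B z)"
  unfolding matrix_matrix_mult_def by (intro continuous_intros assms)

lemma continuous_on_matrix_entries:
  fixes A :: "'b::topological_space \<Rightarrow> 'a::topological_space^'n^'m"
  assumes "\<And>i j. continuous_on S (\<lambda>z. A z $ i $ j)"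
  shows "continuous_on S A"
proof -
  have "continuous_on S (\<lambda>z. \<chi> i j. A z $ i $ j)" by (intro continuous_on_vec_lambda assms)
  then show ?thesis by simp
qed

lemma continuous_on_matrix_inv:
  fixes A :: "'b::topological_space \<Rightarrow> 'a::real_normed_field^'n^'n"
  assumes "continuous_on S A" "\<And>z. z \<in> S \<Longrightarrow> det (A z) \<noteq> 0"
  shows "continuous_on S (\<lambda>z. matrix_inv (A z))"
proof -
  have "continuous_on S (\<lambda>z. adjugate (A z) $ i $ j / det (A z))" for i j
  proof (intro continuous_on_divide)
    show "continuous_on S (\<lambda>z. adjugate (A z) $ i $ j)"
      unfolding adjugate_def vec_lambda_beta
    proof (rule continuous_on_det)
      fix a b
      show "continuous_on S (\<lambda>z. (\<chi> a b. if b = i then axis j 1 $ a else A z $ a $ b) $ a $ b)"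
        by (cases "b = i") (auto intro!: continuous_intros assms)
    qed
  qed (auto intro!: continuous_on_det continuous_intros assms)
  then have "continuous_on S (\<lambda>z. matrix_inv (A z) $ i $ j)" for i j
    by (rule continuous_on_eq) (simp add: assms(2) matrix_inv_nth)
  then show ?thesis by (rule continuous_on_matrix_entries)
qed

section \<open>Paths of idempotents with prescribed diagonal\<close>

text \<open>The set of the theorem in working form, with the commutant condition replaced by its
  dual and the diagonal matrix by the vector of its entries.\<close>

definition surjective_idempotents :: "complex^'n \<Rightarrow> (complex^'n^'n) set" where
  "surjective_idempotents \<delta> = {q. q ** q = q \<and> diag_vec q = \<delta> \<and> traceless_surj q}"

text \<open>The property is equivalent to a condition on the range projection, hence depends on the
  range alone.\<close>

lemma traceless_surj_same_range:
  assumes "p ** p = p" "q ** q = q" "p ** q = q" "q ** p = p" "traceless_surj q"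
  shows "traceless_surj p"
proof -
  have "range_projection p = range_projection q"
    using same_range_iff[OF assms(1,2)] assms(3,4) by (simp add: range_projection_def)
  then show ?thesis
    using assms trivial_commutant_iff_traceless_surj[of p] trivial_commutant_iff_traceless_surj[of q]
    by simp
qed

text \<open>Idempotents with a common range form an affine space, and the diagonal is an affine
  function on it, so the straight segment stays in the set.\<close>

lemma path_component_same_range:
  fixes p q :: "complex^'n^'n"
  assumes "p \<in> surjective_idempotents \<delta>" "q \<in> surjective_idempotents \<delta>"
    and "p ** q = q" "q ** p = p"
  shows "path_component (surjective_idempotents \<delta>) p q"
proof -
  have pp: "p ** p = p" and qq: "q ** q = q" and dp: "diag_vec p = \<delta>" and dq: "diag_vec q = \<delta>"
    and sp: "traceless_surj p"
    using assms(1,2) by (auto simp: surjective_idempotents_def)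
  have "(1 - t) *\<^sub>R p + t *\<^sub>R q \<in> surjective_idempotents \<delta>" for t :: real
  proof -
    define r where "r = (1 - t) *\<^sub>R p + t *\<^sub>R q"
    have scale: "(s *\<^sub>R x) ** y = s *\<^sub>R (x ** y)" "x ** (s *\<^sub>R y) = s *\<^sub>R (x ** y)"
      for s and x y :: "complex^'n^'n"
      by (simp_all add: matrix_matrix_mult_def vec_eq_iff scaleR_sum_right)
    have pr: "p ** r = r" and rp: "r ** p = p" and rq: "r ** q = q"
      unfolding r_def
      by (simp_all add: matrix_algebra scale pp qq assms(3,4) flip: scaleR_left_distrib)
    \<comment> \<open>With \<open>x = r\<close>, which fixes both \<open>p\<close> and
      \<open>q\<close> from the left, the right-hand side is \<open>r\<close> itself.\<close>
    have "x ** r = (1 - t) *\<^sub>R (x ** p) + t *\<^sub>R (x ** q)" for x :: "complex^'n^'n"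
      unfolding r_def by (simp add: matrix_algebra scale)
    from this[of r] have rr: "r ** r = r" unfolding rp rq by (simp add: r_def)
    have "diag_vec r = (1 - t) *\<^sub>R diag_vec p + t *\<^sub>R diag_vec q"
      by (simp add: r_def diag_vec_def vec_eq_iff)
    then have "diag_vec r = \<delta>" by (simp add: dp dq flip: scaleR_left_distrib)
    then show ?thesis
      using rr traceless_surj_same_range[OF rr pp rp pr sp]
      by (simp add: surjective_idempotents_def r_def)
  qed
  then have "closed_segment p q \<subseteq> surjective_idempotents \<delta>" by (auto simp: closed_segment_def)
  then show ?thesis unfolding path_component_def
    by (intro exI[of _ "linepath p q"]) simp
qed

text \<open>The idempotents with the range of an idempotent \<open>e\<close> are the matrices
  \<open>e + e ** x ** (mat 1 - e)\<close>. Along the family of ranges \<open>h z (range q)\<close> the linear system that prescribes the diagonal has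
  a determinant which is polynomial in \<open>z\<close> up to a power of \<open>det (h z)\<close> and does not vanish at
  \<open>z0\<close>; hence it is solvable off a finite subset of the complex plane.\<close>

lemma path_component_move_range:
  fixes q :: "complex^'n^'n" and h :: "complex \<Rightarrow> complex^'n^'n"
  assumes q: "q \<in> surjective_idempotents \<delta>"
    and h: "\<And>i j. poly_fun (\<lambda>z. h z $ i $ j)" and hz0: "h z0 = mat 1"
  obtains F where "finite F"
    "\<forall>z. z \<notin> F \<longrightarrow> (\<exists>q'. path_component (surjective_idempotents \<delta>) q q' \<and>
       q' ** (h z ** q ** matrix_inv (h z)) = h z ** q ** matrix_inv (h z) \<and>
       h z ** q ** matrix_inv (h z) ** q' = q')"
proof -
  have qq: "q ** q = q" and dq: "diag_vec q = \<delta>" and sq: "traceless_surj q"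
    using q by (auto simp: surjective_idempotents_def)
  define N :: complex where "N = of_nat CARD('n)"
  have N0: "N \<noteq> 0" by (simp add: N_def)
  define k where "k = mat 1 - q"
  have kq: "k ** q = 0"
    by (simp add: k_def matrix_diff_rdistrib qq)
  \<comment> \<open>Subtracting the mean \<open>1 / N\<close> moves the unit vectors into the space
    of vectors with sum zero, where preimages \<open>y i\<close> exist.\<close>
  have "\<exists>y. diag_vec (q ** y ** k) = axis i 1 - (\<chi> j. 1 / N)" for i
  proof -
    have "(\<Sum>j\<in>UNIV. (axis i 1 - (\<chi> j. 1 / N)) $ j) = 0"
      using N0 by (simp add: sum_subtractf axis_def N_def)
    then show ?thesis using sq unfolding traceless_surj_def k_def by blast
  qed
  then obtain y where y: "\<And>i. diag_vec (q ** y i ** k) = axis i 1 - (\<chi> j. 1 / N)" by metis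
  \<comment> \<open>Column \<open>i\<close> is \<open>det (h z)\<close> times the diagonal of the
    conjugate of \<open>q ** y i ** k\<close> by \<open>h z\<close>, with the mean
    \<open>1 / N\<close> put back: the factor makes it polynomial, the mean makes
    \<open>T z0\<close> the identity.\<close>
  define T where "T z = (\<chi> l i. (h z ** q ** y i ** k ** adjugate (h z)) $ l $ l + det (h z) / N)" for z
  define J where "J z = matrix_inv (h z)" for z
  have T_poly: "poly_fun (\<lambda>z. T z $ l $ i)" for l i
  proof -
    have "poly_fun (\<lambda>z. (h z ** q ** y i ** k ** adjugate (h z)) $ l $ l + det (h z) * (1 / N))"
      by (intro poly_fun_add poly_fun_mult poly_fun_matrix_mult poly_fun_adjugate poly_fun_det h
          poly_fun_const)
    then show ?thesis by (simp add: T_def)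
  qed
  have "T z0 = mat 1"
  proof -
    have "invertible (mat 1 :: complex^'n^'n)" by (simp add: invertible_det_nz)
    from matrix_inv_works(1)[OF this] have "adjugate (mat 1) = (mat 1 :: complex^'n^'n)"
      by (simp add: vec_eq_iff matrix_inv_nth)
    then have "T z0 $ l $ i = diag_vec (q ** y i ** k) $ l + 1 / N" for l i
      by (simp add: T_def hz0 diag_vec_def)
    then have "T z0 $ l $ i = axis i 1 $ l" for l i by (simp add: y)
    then show ?thesis by (simp add: vec_eq_iff mat_def axis_def)
  qed
  define F where "F = {z. det (h z) = 0} \<union> {z. det (T z) = 0}"
  have z0F: "z0 \<notin> F" by (simp add: F_def hz0 \<open>T z0 = mat 1\<close>)
  have finF: "finite F"
    unfolding F_def
    using finite_zeros_poly_fun[OF poly_fun_det, of h z0] finite_zeros_poly_fun[OF poly_fun_det, of T z0]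
    by (simp add: h T_poly hz0 \<open>T z0 = mat 1\<close>)
  have hJ: "h z ** J z = mat 1" "J z ** h z = mat 1" if "z \<notin> F" for z
    using that matrix_inv_works[of "h z"] by (auto simp: J_def F_def invertible_det_nz)
  have trace_sandwich: "(\<Sum>l\<in>UNIV. (h z ** x ** J z) $ l $ l) = trace x" if "z \<notin> F" for x z
    using trace_mul_sym[of "h z ** x" "J z"] hJ[OF that] by (simp add: matrix_mul_assoc trace_def)
  \<comment> \<open>The unknown matrix is sought as a combination of the \<open>y i\<close>;
    \<open>c v z\<close> is the coefficient vector producing the diagonal \<open>v\<close> over
    \<open>z\<close>.\<close>
  define Y where "Y c = (\<chi> a b. \<Sum>i\<in>UNIV. c $ i * y i $ a $ b)" for c
  define c where "c v z = matrix_inv (T z) *v (det (h z) *s v)" for v z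
  have solve: "diag_vec (h z ** q ** Y (c v z) ** k ** J z) = v"
    if z: "z \<notin> F" and v: "(\<Sum>i\<in>UNIV. v $ i) = 0" for v z
  proof -
    have D: "det (h z) \<noteq> 0" and "invertible (T z)" using z by (auto simp: F_def invertible_det_nz)
    define c' where "c' = c v z"
    have Tc: "T z *v c' = det (h z) *s v"
      by (simp add: c'_def c_def matrix_vector_mul_assoc matrix_inv_works[OF \<open>invertible (T z)\<close>])
    have Tn: "T z $ l $ i = det (h z) * ((h z ** (q ** y i ** k) ** J z) $ l $ l + 1 / N)" for l i
      using D by (simp add: T_def mult_adjugate_nth J_def matrix_mul_assoc distrib_left)
    \<comment> \<open>Since this trace vanishes, only the terms \<open>1 / N\<close> contribute to
      the column sums of \<open>T z\<close>. Hence the coefficients sum to zero when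
      \<open>v\<close> does, and the added mean drops out of the solution.\<close>
    have "trace (q ** y i ** k) = 0" for i
      using trace_mul_sym[of "q ** y i" k] by (simp add: matrix_mul_assoc kq trace_def)
    then have colsum: "(\<Sum>l\<in>UNIV. T z $ l $ i) = det (h z)" for i
      using trace_sandwich[OF z, of "q ** y i ** k"] N0
      by (simp add: Tn sum.distrib flip: sum_distrib_left) (simp add: N_def)
    have "(\<Sum>l\<in>UNIV. (T z *v c') $ l) = (\<Sum>i\<in>UNIV. (\<Sum>l\<in>UNIV. T z $ l $ i) * c' $ i)"
      unfolding matrix_vector_mult_def sum_distrib_right by (simp, rule sum.swap)
    then have "(\<Sum>l\<in>UNIV. (T z *v c') $ l) = det (h z) * (\<Sum>i\<in>UNIV. c' $ i)"
      by (simp add: colsum sum_distrib_left)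
    then have csum: "(\<Sum>i\<in>UNIV. c' $ i) = 0"
      using D v by (simp add: Tc flip: sum_distrib_left)
    have "diag_vec (h z ** q ** Y c' ** k ** J z) $ l = v $ l" for l
    proof -
      have "h z ** q ** Y c' ** k ** J z = (h z ** q) ** Y c' ** (k ** J z)"
        by (simp only: matrix_mul_assoc)
      also have "\<dots> = (\<chi> a b. \<Sum>i\<in>UNIV. c' $ i * ((h z ** q) ** y i ** (k ** J z)) $ a $ b)"
        unfolding Y_def by (rule matrix_sum_sandwich)
      finally have "diag_vec (h z ** q ** Y c' ** k ** J z) $ l
          = (\<Sum>i\<in>UNIV. c' $ i * (h z ** (q ** y i ** k) ** J z) $ l $ l)"
        by (simp add: diag_vec_def matrix_mul_assoc)
      also have "\<dots> = (\<Sum>i\<in>UNIV. c' $ i * ((h z ** (q ** y i ** k) ** J z) $ l $ l + 1 / N))"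
        using csum by (simp add: distrib_left sum.distrib flip: sum_divide_distrib)
      finally have "det (h z) * diag_vec (h z ** q ** Y c' ** k ** J z) $ l = (T z *v c') $ l"
        by (simp add: matrix_vector_mult_def Tn sum_distrib_left mult_ac)
      then show ?thesis using D by (simp add: Tc)
    qed
    then show ?thesis by (simp add: vec_eq_iff c'_def)
  qed
  \<comment> \<open>The idempotent \<open>e z\<close> has the moved range but the wrong diagonal;
    \<open>w z\<close> is the defect, and \<open>Q z\<close> corrects it without changing the
    range.\<close>
  define w where "w z = \<delta> - diag_vec (h z ** q ** J z)" for z
  define Q where "Q z = h z ** (q + q ** Y (c (w z) z) ** k) ** J z" for z
  define e where "e z = h z ** q ** J z" for z
  have wsum: "(\<Sum>i\<in>UNIV. w z $ i) = 0" if "z \<notin> F" for z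
    using trace_sandwich[OF that, of q] dq[symmetric]
    by (simp add: w_def diag_vec_def sum_subtractf trace_def)
  have conj: "(h z ** a ** J z) ** (h z ** b ** J z) = h z ** (a ** b) ** J z" if "z \<notin> F" for a b z
  proof -
    have "(h z ** a ** J z) ** (h z ** b ** J z) = h z ** a ** (J z ** h z) ** b ** J z"
      by (simp add: matrix_mul_assoc)
    then show ?thesis using hJ[OF that] by (simp add: matrix_mul_assoc)
  qed
  have kill: "x ** k ** q = 0" "x ** q ** q = x ** q" for x
    by (simp_all add: kq qq flip: matrix_mul_assoc)
  have Qe: "Q z ** e z = e z" and eQ: "e z ** Q z = Q z" and ee: "e z ** e z = e z"
    and QQ: "Q z ** Q z = Q z" if "z \<notin> F" for z
    unfolding Q_def e_def conj[OF that] by (simp_all add: matrix_algebra kill qq)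
  have "traceless_surj (e z)" if z: "z \<notin> F" for z
    unfolding traceless_surj_def
  proof (intro allI impI)
    fix v :: "complex^'n" assume "(\<Sum>i\<in>UNIV. v $ i) = 0"
    from solve[OF z this] have "diag_vec (h z ** (q ** Y (c v z) ** k) ** J z) = v"
      by (simp add: matrix_mul_assoc)
    moreover have "mat 1 - e z = h z ** k ** J z"
      by (simp add: k_def e_def matrix_algebra hJ[OF z])
    ultimately have "diag_vec (e z ** (h z ** Y (c v z) ** J z) ** (mat 1 - e z)) = v"
      by (simp add: e_def conj[OF z])
    then show "\<exists>y. diag_vec (e z ** y ** (mat 1 - e z)) = v" by blast
  qed
  then have Qmem: "Q z \<in> surjective_idempotents \<delta>" if z: "z \<notin> F" for z
  proof -
    have "Q z = h z ** q ** J z + h z ** q ** Y (c (w z) z) ** k ** J z"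
      by (simp add: Q_def matrix_algebra)
    then have "diag_vec (Q z) = diag_vec (h z ** q ** J z) + w z"
      using solve[OF z wsum[OF z]] by (simp add: diag_vec_def vec_eq_iff)
    then show ?thesis
      using traceless_surj_same_range[OF QQ[OF z] ee[OF z] Qe[OF z] eQ[OF z]] z
        \<open>\<And>z. z \<notin> F \<Longrightarrow> traceless_surj (e z)\<close> QQ[OF z]
      by (simp add: surjective_idempotents_def w_def)
  qed
  \<comment> \<open>At \<open>z0\<close> nothing has moved: the defect is zero, and so is the
    correction.\<close>
  have Qz0: "Q z0 = q"
  proof -
    have "J z0 = mat 1" using hJ[OF z0F] hz0 by simp
    moreover from this have "c (w z0) z0 = 0" by (simp add: c_def w_def hz0 dq)
    moreover have "Y 0 = 0" by (simp add: Y_def vec_eq_iff)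
    ultimately show ?thesis by (simp add: Q_def hz0)
  qed
  have cont: "continuous_on (- F) Q"
  proof -
    have ch: "continuous_on (- F) h" and cT: "continuous_on (- F) T"
      by (intro continuous_on_matrix_entries continuous_on_poly_fun h T_poly)+
    have cJ: "continuous_on (- F) J" 
      unfolding J_def by (rule continuous_on_matrix_inv[OF ch]) (simp add: F_def)
    have cTi: "continuous_on (- F) (\<lambda>z. matrix_inv (T z))" 
      by (rule continuous_on_matrix_inv[OF cT]) (simp add: F_def)
    have cw: "continuous_on (- F) w"
      unfolding w_def diag_vec_def by (intro continuous_intros ch cJ)
    have cc: "continuous_on (- F) (\<lambda>z. c (w z) z)"
      unfolding c_def matrix_vector_mult_def vector_scalar_mult_def
      by (intro continuous_intros continuous_on_det cTi ch cw)
    show ?thesis unfolding Q_def Y_def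
      by (intro continuous_intros ch cJ cc)
  qed
  \<comment> \<open>Here the parameter has to be complex: a finite set does not disconnect the
    plane, whereas it could disconnect a real interval.\<close>
  have conn: "path_connected (Q ` (- F))"
    using path_connected_complement_countable[of F] finF cont
    by (intro path_connected_continuous_image) (auto intro: countable_finite)
  show ?thesis
  proof (rule that[OF finF], intro allI impI)
    fix z assume z: "z \<notin> F"
    have "path_component (Q ` (- F)) (Q z0) (Q z)"
      using conn z z0F unfolding path_connected_component by blast
    then have "path_component (surjective_idempotents \<delta>) q (Q z)"
      unfolding Qz0 by (rule path_component_of_subset[rotated]) (use Qmem in auto)
    then show "\<exists>q'. path_component (surjective_idempotents \<delta>) q q' \<and>
       q' ** (h z ** q ** matrix_inv (h z)) = h z ** q ** matrix_inv (h z) \<and>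
       h z ** q ** matrix_inv (h z) ** q' = q'"
      using Qe[OF z] eQ[OF z] unfolding e_def J_def by blast
  qed
qed

theorem theorem7p4:
  fixes d :: "complex^'n^'n"
  assumes "d \<in> diagonal_algebra"
    and "{q :: complex^'n^'n. idempotent_matrix q \<and> diagonal_part q = d \<and>
            commutant (range_projection q) \<inter> diagonal_algebra = scalar_matrices} \<noteq> {}"
  shows "path_connected {q :: complex^'n^'n. idempotent_matrix q \<and> diagonal_part q = d \<and>
            commutant (range_projection q) \<inter> diagonal_algebra = scalar_matrices}"
proof -
  define \<delta> where "\<delta> = diag_vec d"
  have "diagonal_part q = d \<longleftrightarrow> diag_vec q = \<delta>" for q
    using assms(1)
    by (auto simp: diagonal_part_def diag_vec_def \<delta>_def vec_eq_iff diagonal_algebra_def)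
  then have set_eq: "{q :: complex^'n^'n. idempotent_matrix q \<and> diagonal_part q = d \<and>
      commutant (range_projection q) \<inter> diagonal_algebra = scalar_matrices} = surjective_idempotents \<delta>"
    using trivial_commutant_iff_traceless_surj
    by (auto simp: surjective_idempotents_def idempotent_matrix_def)
  have "path_component (surjective_idempotents \<delta>) p q"
    if p: "p \<in> surjective_idempotents \<delta>" and q: "q \<in> surjective_idempotents \<delta>" for p q
  proof -
    have pp: "p ** p = p" and qq: "q ** q = q" and dpq: "diag_vec p = diag_vec q"
      using p q by (auto simp: surjective_idempotents_def)
    have "trace p = trace q" using dpq by (simp add: diag_vec_def trace_def vec_eq_iff)
    then obtain g where g: "invertible g" and qg: "q ** g = g ** p"
      using idempotents_similar[OF pp qq] by metis
    define G where "G = matrix_inv g"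
    have gG: "g ** G = mat 1" "G ** g = mat 1" using matrix_inv_works[OF g] by (simp_all add: G_def)
    define h where "h z = (\<chi> i j. (1 - z) * mat 1 $ i $ j + z * g $ i $ j)" for z
    have h_poly: "poly_fun (\<lambda>z. h z $ i $ j)" for i j
      unfolding h_def vec_lambda_beta
      by (intro poly_fun_add poly_fun_mult poly_fun_diff poly_fun_const poly_fun_ident)
    have h01: "h 0 = mat 1" "h 1 = g" by (simp_all add: h_def vec_eq_iff)
    obtain F0 where F0: "finite F0"
      "\<forall>z. z \<notin> F0 \<longrightarrow> (\<exists>q'. path_component (surjective_idempotents \<delta>) p q' \<and>
       q' ** (h z ** p ** matrix_inv (h z)) = h z ** p ** matrix_inv (h z) \<and>
       h z ** p ** matrix_inv (h z) ** q' = q')"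
      by (rule path_component_move_range[OF p h_poly h01(1)])
    \<comment> \<open>Multiplication by \<open>G\<close> normalises the family to be the identity at
      \<open>z = 1\<close>, so that it can be followed from \<open>q\<close> as well.\<close>
    have hG_poly: "poly_fun (\<lambda>z. (h z ** G) $ i $ j)" for i j
      by (intro poly_fun_matrix_mult h_poly poly_fun_const)
    have hG1: "h 1 ** G = mat 1" by (simp add: h01 gG)
    obtain F1 where F1: "finite F1"
      "\<forall>z. z \<notin> F1 \<longrightarrow> (\<exists>q'. path_component (surjective_idempotents \<delta>) q q' \<and>
       q' ** (h z ** G ** q ** matrix_inv (h z ** G)) = h z ** G ** q ** matrix_inv (h z ** G) \<and>
       h z ** G ** q ** matrix_inv (h z ** G) ** q' = q')"
      by (rule path_component_move_range[where h = "\<lambda>z. h z ** G", OF q hG_poly hG1])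
    have "finite {z. det (h z) = 0}"
      by (rule finite_zeros_poly_fun[OF poly_fun_det[OF h_poly], of 0]) (simp add: h01)
    with F0(1) F1(1) have fin: "finite (F0 \<union> F1 \<union> {z. det (h z) = 0})" by simp
    obtain z where z: "z \<notin> F0" "z \<notin> F1" "det (h z) \<noteq> 0"
      using ex_new_if_finite[OF infinite_UNIV_char_0 fin] by auto
    define e where "e = h z ** p ** matrix_inv (h z)"
    have hJ: "h z ** matrix_inv (h z) = mat 1" "matrix_inv (h z) ** h z = mat 1"
      using matrix_inv_works[of "h z"] z(3) by (simp_all add: invertible_det_nz)
    have GqgG: "G ** q = p ** G"
    proof -
      have "G ** q = G ** (q ** g) ** G" by (simp add: gG flip: matrix_mul_assoc)
      also have "\<dots> = p ** G" by (simp add: qg gG matrix_mul_assoc)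
      finally show ?thesis .
    qed
    \<comment> \<open>Both families lead to the same idempotent over \<open>z\<close>, because
      \<open>G\<close> conjugates \<open>q\<close> into \<open>p\<close>.\<close>
    have "h z ** G ** q ** matrix_inv (h z ** G) = e"
    proof -
      have inv: "invertible (h z ** G)"
      proof (rule invertible_mult)
        show "invertible (h z)" using z(3) by (simp add: invertible_det_nz)
        show "invertible G" using gG by (auto simp: invertible_def)
      qed
      have "h z ** G ** q ** matrix_inv (h z ** G) = h z ** p ** G ** matrix_inv (h z ** G)"
        by (simp add: GqgG flip: matrix_mul_assoc)
      also have "\<dots> = h z ** p ** (matrix_inv (h z) ** h z) ** G ** matrix_inv (h z ** G)"
        by (simp add: hJ)
      also have "\<dots> = e ** ((h z ** G) ** matrix_inv (h z ** G))"
        by (simp add: e_def matrix_mul_assoc)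
      also have "\<dots> = e" by (simp add: matrix_inv_works[OF inv])
      finally show ?thesis .
    qed
    then obtain p' q' where
      p': "path_component (surjective_idempotents \<delta>) p p'" "p' ** e = e" "e ** p' = p'" and
      q': "path_component (surjective_idempotents \<delta>) q q'" "q' ** e = e" "e ** q' = q'"
      using F0(2) F1(2) z unfolding e_def by metis
    \<comment> \<open>Both \<open>p'\<close> and \<open>q'\<close> have the range of
      \<open>e\<close>, hence each fixes the range of the other.\<close>
    have "p' ** e ** q' = q'" "q' ** e ** p' = p'" by (simp_all only: p'(2,3) q'(2,3))
    then have "p' ** q' = q'" "q' ** p' = p'" unfolding matrix_mul_assoc[symmetric] p'(3) q'(3) .
    with p'(1) q'(1) have "path_component (surjective_idempotents \<delta>) p' q'"
      by (intro path_component_same_range) (auto dest: path_component_mem)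
    then show ?thesis using p'(1) q'(1) by (meson path_component_sym path_component_trans)
  qed
  then show ?thesis unfolding set_eq path_connected_component by blast
qed

end
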